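(* Let $A$ be a $\mathbb{Z}$-graded abelian Lie algebra, $\mathcal{Q}$ the quadratic Lie superalgebra and $\mathfrak{g}=A\oplus\mathcal{Q}$. Suppose that - $\lambda\in\mathfrak{k}_0^*$ is a coradical-finite linear functional with corresponding finite dimensional simple $\mathfrak{k}$-module $V:=V_{c,\lambda}$, - $\varrho$ is a linear functional on $\mathscr{S}=s^2\mathbb{C}[s^{\pm4}]$, - $\varphi:\mathscr{S}\to\mathrm{End}(V)$ is a linear map taking values in even endomorphisms and satisfying $\varphi(z)(xv)-x\varphi(z)v=[z,x]v$ and $\varphi(z)\varphi(z')v-\varphi(z')\varphi(z)v=0$ for all $x\in\mathfrak{k}$, $z,z'\in\mathscr{S}$ and $v\in V$. Set $\Omega=\Omega_{\lambda,\varrho,\varphi}(V):=V$ and define $\cdot:\mathfrak{g}\times\Omega\to\Omega$ (extended linearly in $\mathfrak{g}=\mathfrak{k}\oplus\mathscr{S}$) by $x\cdot v=xv$ for $x\in\mathfrak{k}$ and $x\cdot v=\varrho(x)v+\varphi(x)v$ for $x\in\mathscr{S}$. Then $\Omega$ is a finite dimensional simple $\mathfrak{g}$-module.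
   Context: Ground field $\mathbb{C}$. The quadratic Lie superalgebra is $\mathcal{Q}=\mathcal{Q}_0\oplus\mathcal{Q}_1$, $\mathcal{Q}_0=s^2\mathbb{C}[s^{\pm4}]\oplus t^2\mathbb{C}[t^{\pm4}]$, $\mathcal{Q}_1=t\mathbb{C}[t^{\pm4}]\oplus t^{-1}\mathbb{C}[t^{\pm4}]$ (here $s^{4k+2},t^{4k+2},t^{4k\pm1}$, $k\in\mathbb{Z}$, are basis vectors), with the super-antisymmetric bracket determined, for $k,k'\in\mathbb{Z}$, by $[\mathcal{Q}_0,\mathcal{Q}_0]=[t^2\mathbb{C}[t^{\pm4}],\mathcal{Q}_1]=\{0\}$, $[t^{4k+1},t^{4k'-1}]=0$, $[t^{4k+1},t^{4k'+1}]=t^{4(k+k')+2}$, $[t^{4k-1},t^{4k'-1}]=-t^{4(k+k')-2}$, $[s^{4k-2},t^{4k'+1}]=t^{4(k+k')-1}$, $[s^{4k+2},t^{4k'-1}]=t^{4(k+k')+1}$. $\mathfrak{g}=A\oplus\mathcal{Q}$ is the direct sum of Lie superalgebras ($A$ purely even), and $\mathfrak{k}=A\oplus t^2\mathbb{C}[t^{\pm4}]\oplus t\mathbb{C}[t^{\pm4}]\oplus t^{-1}\mathbb{C}[t^{\pm4}]$, with $\mathfrak{k}_0=A\oplus t^2\mathbb{C}[t^{\pm4}]$, $\mathfrak{k}_1=\mathfrak{g}_1=\mathcal{Q}_1$; thus $\mathfrak{g}=\mathfrak{k}\oplus\mathscr{S}$ with $\mathscr{S}=s^2\mathbb{C}[s^{\pm4}]$.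 Modules are $\mathbb{Z}_2$-graded; a module homomorphism is a $\mathbb{Z}_2$-homogeneous linear map $\psi$ (even or odd) with $\psi(xv)=x\psi(v)$. For $\lambda\in\mathfrak{k}_0^*$, $f_\lambda:\mathfrak{k}_1\times\mathfrak{k}_1\to\mathbb{C}$ is the symmetric bilinear form $f_\lambda(x,y)=\lambda([x,y])$; $\lambda$ is coradical-finite if $\mathfrak{k}_1/\mathrm{rad}(f_\lambda)$ is finite dimensional. For coradical-finite $\lambda$, $V_{c,\lambda}$ denotes the unique (up to isomorphism) finite dimensional simple $\mathfrak{k}$-module on which each $x\in\mathfrak{k}_0$ acts as the scalar $\lambda(x)$; it is the unique finite dimensional simple module over the Clifford superalgebra generated by odd elements $\bar x\in\mathfrak{k}_1/\mathrm{rad}(f_\lambda)$ subject to $\bar x\bar y+\bar y\bar x=f_\lambda(x,y)$. *)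

theory Defs
  imports Complex_Main "HOL-Library.Poly_Mapping" "HOL-Library.Product_Plus" "HOL-Library.Z2"
begin

section \<open>Lie superalgebras over the complex numbers and their modules\<close>

text \<open>
  Superspaces are given by their homogeneous parts, indexed by the two-element field
  \<^typ>\<open>bit\<close>. Lie superalgebras live on the subset \<^term>\<open>supercarrier L\<close> of a type, so that
  subalgebras of a fixed algebra can be treated; linear maps defined on such subsets are total
  functions of which only the values on the subset matter.
\<close>

definition supercarrier :: "(bit \<Rightarrow> 'g::ab_group_add set) \<Rightarrow> 'g set" where
  "supercarrier L = {x + y | x y. x \<in> L 0 \<and> y \<in> L 1}"

definition super_sign :: "bit \<Rightarrow> bit \<Rightarrow> complex" where
  "super_sign i j = (if i = 1 \<and> j = 1 then -1 else 1)"

definition linear_on ::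
  "(complex \<Rightarrow> 'u::ab_group_add \<Rightarrow> 'u) \<Rightarrow> (complex \<Rightarrow> 'w::ab_group_add \<Rightarrow> 'w) \<Rightarrow> 'u set \<Rightarrow> ('u \<Rightarrow> 'w) \<Rightarrow> bool"
  where
  "linear_on s1 s2 U f \<longleftrightarrow>
     (\<forall>x\<in>U. \<forall>y\<in>U. f (x + y) = f x + f y) \<and> (\<forall>c. \<forall>x\<in>U. f (s1 c x) = s2 c (f x))"

locale lie_superalgebra = vector_space scale
  for scale :: "complex \<Rightarrow> 'g::ab_group_add \<Rightarrow> 'g" +
  fixes L :: "bit \<Rightarrow> 'g set"
    and br :: "'g \<Rightarrow> 'g \<Rightarrow> 'g"
  assumes L_subspace: "subspace (L i)"
    and L_direct: "L 0 \<inter> L 1 = {0}"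
    and br_linear_left: "y \<in> supercarrier L \<Longrightarrow> linear_on scale scale (supercarrier L) (\<lambda>x. br x y)"
    and br_linear_right: "x \<in> supercarrier L \<Longrightarrow> linear_on scale scale (supercarrier L) (br x)"
    and br_graded: "x \<in> L i \<Longrightarrow> y \<in> L j \<Longrightarrow> br x y \<in> L (i + j)"
    and br_skew: "x \<in> L i \<Longrightarrow> y \<in> L j \<Longrightarrow> br x y = - scale (super_sign i j) (br y x)"
    and br_jacobi: "x \<in> L i \<Longrightarrow> y \<in> L j \<Longrightarrow> z \<in> L k \<Longrightarrow>
       br x (br y z) = br (br x y) z + scale (super_sign i j) (br y (br x z))"

locale lie_supermodule = lie_superalgebra scale L br + V: vector_space sV
  for scale :: "complex \<Rightarrow> 'g::ab_group_add \<Rightarrow> 'g"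
    and L :: "bit \<Rightarrow> 'g set"
    and br :: "'g \<Rightarrow> 'g \<Rightarrow> 'g"
    and sV :: "complex \<Rightarrow> 'v::ab_group_add \<Rightarrow> 'v" +
  fixes V :: "bit \<Rightarrow> 'v set"
    and act :: "'g \<Rightarrow> 'v \<Rightarrow> 'v"
  assumes V_subspace: "V.subspace (V i)"
    and V_direct: "V 0 \<inter> V 1 = {0}"
    and V_total: "supercarrier V = UNIV"
    and act_linear_left: "linear_on scale sV (supercarrier L) (\<lambda>x. act x v)"
    and act_linear_right: "x \<in> supercarrier L \<Longrightarrow> Vector_Spaces.linear sV sV (act x)"
    and act_graded: "x \<in> L i \<Longrightarrow> v \<in> V j \<Longrightarrow> act x v \<in> V (i + j)"
    and act_br: "x \<in> L i \<Longrightarrow> y \<in> L j \<Longrightarrow>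
       act (br x y) v = act x (act y v) - sV (super_sign i j) (act y (act x v))"

text \<open>Modules are graded, hence so are submodules, and simplicity refers to graded submodules.\<close>

definition graded_submodule ::
  "(bit \<Rightarrow> 'g::ab_group_add set) \<Rightarrow> (complex \<Rightarrow> 'v::ab_group_add \<Rightarrow> 'v) \<Rightarrow> (bit \<Rightarrow> 'v set) \<Rightarrow>
   ('g \<Rightarrow> 'v \<Rightarrow> 'v) \<Rightarrow> 'v set \<Rightarrow> bool" where
  "graded_submodule L sV V act W \<longleftrightarrow>
     module.subspace sV W \<and>
     W = supercarrier (\<lambda>i. W \<inter> V i) \<and>
     (\<forall>x\<in>supercarrier L. \<forall>w\<in>W. act x w \<in> W)"

definition simple_supermodule ::
  "(complex \<Rightarrow> 'g::ab_group_add \<Rightarrow> 'g) \<Rightarrow> (bit \<Rightarrow> 'g set) \<Rightarrow> ('g \<Rightarrow> 'g \<Rightarrow> 'g) \<Rightarrow>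
   (complex \<Rightarrow> 'v::ab_group_add \<Rightarrow> 'v) \<Rightarrow> (bit \<Rightarrow> 'v set) \<Rightarrow> ('g \<Rightarrow> 'v \<Rightarrow> 'v) \<Rightarrow> bool" where
  "simple_supermodule scale L br sV V act \<longleftrightarrow>
     lie_supermodule scale L br sV V act \<and>
     (\<exists>v::'v. v \<noteq> 0) \<and>
     (\<forall>W. graded_submodule L sV V act W \<longrightarrow> W = {0} \<or> W = UNIV)"

definition finite_dimensional :: "(complex \<Rightarrow> 'v::ab_group_add \<Rightarrow> 'v) \<Rightarrow> bool" where
  "finite_dimensional sV \<longleftrightarrow> (\<exists>B. finite_dimensional_vector_space sV B)"

definition linear_even_endo ::
  "(complex \<Rightarrow> 'v::ab_group_add \<Rightarrow> 'v) \<Rightarrow> (bit \<Rightarrow> 'v set) \<Rightarrow> ('v \<Rightarrow> 'v) \<Rightarrow> bool" where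
  "linear_even_endo sV V f \<longleftrightarrow> Vector_Spaces.linear sV sV f \<and> (\<forall>i. f ` V i \<subseteq> V i)"

locale graded_abelian_lie_algebra =
  lie_superalgebra sA "\<lambda>i. if i = 0 then UNIV else {0}" brA
  for sA :: "complex \<Rightarrow> 'a::ab_group_add \<Rightarrow> 'a"
    and brA :: "'a \<Rightarrow> 'a \<Rightarrow> 'a" +
  fixes G :: "int \<Rightarrow> 'a set"
  assumes abelian: "brA x y = 0"
    and G_subspace: "subspace (G n)"
    and G_direct_sum: "\<exists>!f::int \<Rightarrow> 'a.
          (\<forall>n. f n \<in> G n) \<and> finite {n. f n \<noteq> 0} \<and> x = (\<Sum>n | f n \<noteq> 0. f n)"
    and G_graded: "x \<in> G m \<Longrightarrow> y \<in> G n \<Longrightarrow> brA x y \<in> G (m + n)"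


section \<open>The quadratic Lie superalgebra\<close>

text \<open>
  For an integer \<open>k\<close>, the indices \<open>S2 k\<close>, \<open>T2 k\<close>, \<open>T1 k\<close>, \<open>Tm1 k\<close> stand for the basis vectors
  $s^{4k+2}$, $t^{4k+2}$, $t^{4k+1}$, $t^{4k-1}$, respectively.
\<close>

datatype quad_index = S2 int | T2 int | T1 int | Tm1 int

type_synonym quad = "quad_index \<Rightarrow>\<^sub>0 complex"

abbreviation qbasis :: "quad_index \<Rightarrow> quad" where
  "qbasis b \<equiv> Poly_Mapping.single b 1"

definition quad_scale :: "complex \<Rightarrow> quad \<Rightarrow> quad" where
  "quad_scale c = Poly_Mapping.map ((*) c)"

fun quad_parity :: "quad_index \<Rightarrow> bit" where
  "quad_parity (S2 k) = 0"
| "quad_parity (T2 k) = 0"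
| "quad_parity (T1 k) = 1"
| "quad_parity (Tm1 k) = 1"

definition quad_part :: "bit \<Rightarrow> quad set" where
  "quad_part i = {q. \<forall>b\<in>Poly_Mapping.keys q. quad_parity b = i}"

text \<open>
  Index shifts: $-t^{4(k+k')-2}$ is minus the vector of \<open>T2 (k + k' - 1)\<close>, and the rule
  $[s^{4j-2}, t^{4k'+1}] = t^{4(j+k')-1}$ is used with $j = k + 1$. The two clauses with \<open>S2\<close> in
  second position come from super-antisymmetry; the unlisted brackets vanish.
\<close>

fun quad_basis_bracket :: "quad_index \<Rightarrow> quad_index \<Rightarrow> quad" where
  "quad_basis_bracket (T1 k) (T1 k') = qbasis (T2 (k + k'))"
| "quad_basis_bracket (Tm1 k) (Tm1 k') = - qbasis (T2 (k + k' - 1))"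
| "quad_basis_bracket (S2 k) (T1 k') = qbasis (Tm1 (k + 1 + k'))"
| "quad_basis_bracket (T1 k') (S2 k) = - qbasis (Tm1 (k + 1 + k'))"
| "quad_basis_bracket (S2 k) (Tm1 k') = qbasis (T1 (k + k'))"
| "quad_basis_bracket (Tm1 k') (S2 k) = - qbasis (T1 (k + k'))"
| "quad_basis_bracket _ _ = 0"

definition quad_bracket :: "quad \<Rightarrow> quad \<Rightarrow> quad" where
  "quad_bracket x y =
     (\<Sum>b\<in>Poly_Mapping.keys x. \<Sum>b'\<in>Poly_Mapping.keys y.
        quad_scale (Poly_Mapping.lookup x b * Poly_Mapping.lookup y b') (quad_basis_bracket b b'))"


section \<open>The algebra \<open>g = A \<oplus> Q\<close>, its subalgebra \<open>k\<close> and the complement \<open>S\<close>\<close>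

definition g_scale :: "(complex \<Rightarrow> 'a \<Rightarrow> 'a) \<Rightarrow> complex \<Rightarrow> 'a \<times> quad \<Rightarrow> 'a \<times> quad" where
  "g_scale sA c x = (sA c (fst x), quad_scale c (snd x))"

definition g_bracket :: "('a \<Rightarrow> 'a \<Rightarrow> 'a) \<Rightarrow> 'a \<times> quad \<Rightarrow> 'a \<times> quad \<Rightarrow> 'a \<times> quad" where
  "g_bracket brA x y = (brA (fst x) (fst y), quad_bracket (snd x) (snd y))"

definition g_part :: "bit \<Rightarrow> ('a::ab_group_add \<times> quad) set" where
  "g_part i = (if i = 0 then UNIV else {0}) \<times> quad_part i"

definition k_part :: "bit \<Rightarrow> ('a::ab_group_add \<times> quad) set" where
  "k_part i = (if i = 0 then UNIV \<times> {q. Poly_Mapping.keys q \<subseteq> range T2} else g_part 1)"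

definition S_space :: "('a::ab_group_add \<times> quad) set" where
  "S_space = {0} \<times> {q. Poly_Mapping.keys q \<subseteq> range S2}"

text \<open>The projections belonging to the vector space decomposition \<open>g = k \<oplus> S\<close>.\<close>

definition S_proj :: "'a::ab_group_add \<times> quad \<Rightarrow> 'a \<times> quad" where
  "S_proj x = (0, Poly_Mapping.mapp (\<lambda>b c. if b \<in> range S2 then c else 0) (snd x))"

definition k_proj :: "'a::ab_group_add \<times> quad \<Rightarrow> 'a \<times> quad" where
  "k_proj x = x - S_proj x"


section \<open>Coradical-finite functionals, the modules \<open>V\<^sub>c\<^sub>,\<^sub>\<lambda>\<close> and \<open>\<Omega>\<close>\<close>

definition f_form ::
  "('a \<Rightarrow> 'a \<Rightarrow> 'a) \<Rightarrow> ('a \<times> quad \<Rightarrow> complex) \<Rightarrow> 'a \<times> quad \<Rightarrow> 'a \<times> quad \<Rightarrow> complex" where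
  "f_form brA lam x y = lam (g_bracket brA x y)"

definition f_rad ::
  "('a \<Rightarrow> 'a \<Rightarrow> 'a) \<Rightarrow> ('a \<times> quad \<Rightarrow> complex) \<Rightarrow> ('a::ab_group_add \<times> quad) set" where
  "f_rad brA lam = {x \<in> k_part 1. \<forall>y\<in>k_part 1. f_form brA lam x y = 0}"

text \<open>
  The elements of the quotient \<open>U / W\<close> are the cosets \<^term>\<open>(+) x ` W\<close> for \<open>x\<close> in \<open>U\<close>. It is finite
  dimensional iff it is spanned by finitely many cosets, that is, iff it is the image of
  the span of a finite subset of \<open>U\<close> under the canonical projection.
\<close>

definition quotient_finite_dimensional ::
  "(complex \<Rightarrow> 'u::ab_group_add \<Rightarrow> 'u) \<Rightarrow> 'u set \<Rightarrow> 'u set \<Rightarrow> bool" where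
  "quotient_finite_dimensional s U W \<longleftrightarrow>
     (\<exists>B. finite B \<and> B \<subseteq> U \<and> (\<lambda>x. (+) x ` W) ` U = (\<lambda>x. (+) x ` W) ` module.span s B)"

definition coradical_finite ::
  "(complex \<Rightarrow> 'a::ab_group_add \<Rightarrow> 'a) \<Rightarrow> ('a \<Rightarrow> 'a \<Rightarrow> 'a) \<Rightarrow> ('a \<times> quad \<Rightarrow> complex) \<Rightarrow> bool" where
  "coradical_finite sA brA lam \<longleftrightarrow>
     quotient_finite_dimensional (g_scale sA) (k_part 1) (f_rad brA lam)"

text \<open>
  \<open>V\<^sub>c\<^sub>,\<^sub>\<lambda>\<close> is determined only up to isomorphism, so it is rendered as a predicate on modules.
\<close>

definition is_V_c ::
  "(complex \<Rightarrow> 'a::ab_group_add \<Rightarrow> 'a) \<Rightarrow> ('a \<Rightarrow> 'a \<Rightarrow> 'a) \<Rightarrow> ('a \<times> quad \<Rightarrow> complex) \<Rightarrow>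
   (complex \<Rightarrow> 'v::ab_group_add \<Rightarrow> 'v) \<Rightarrow> (bit \<Rightarrow> 'v set) \<Rightarrow> ('a \<times> quad \<Rightarrow> 'v \<Rightarrow> 'v) \<Rightarrow> bool" where
  "is_V_c sA brA lam sV V act \<longleftrightarrow>
     simple_supermodule (g_scale sA) k_part (g_bracket brA) sV V act \<and>
     finite_dimensional sV \<and>
     (\<forall>x\<in>k_part 0. \<forall>v. act x v = sV (lam x) v)"

definition Omega_act ::
  "(complex \<Rightarrow> 'v::ab_group_add \<Rightarrow> 'v) \<Rightarrow> ('a::ab_group_add \<times> quad \<Rightarrow> 'v \<Rightarrow> 'v) \<Rightarrow>
   ('a \<times> quad \<Rightarrow> complex) \<Rightarrow> ('a \<times> quad \<Rightarrow> 'v \<Rightarrow> 'v) \<Rightarrow> 'a \<times> quad \<Rightarrow> 'v \<Rightarrow> 'v" where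
  "Omega_act sV act rho phi x v =
     act (k_proj x) v + (sV (rho (S_proj x)) v + phi (S_proj x) v)"


section \<open>The definitions describe Lie superalgebras, and \<open>\<Omega>\<close> extends the actions of \<open>k\<close> and \<open>S\<close>\<close>

lemma lookup_quad_scale [simp]:
  "Poly_Mapping.lookup (quad_scale c q) b = c * Poly_Mapping.lookup q b"
  unfolding quad_scale_def by transfer (auto simp: when_def)

lemma vector_space_quad_scale: "vector_space quad_scale"
  by unfold_locales (auto intro!: poly_mapping_eqI simp: lookup_add algebra_simps)

interpretation Q: vector_space quad_scale
  by (rule vector_space_quad_scale)

lemma vector_space_g_scale:
  assumes "vector_space sA"
  shows "vector_space (g_scale sA)"
proof -
  interpret A: vector_space sA by fact
  show ?thesis
    by unfold_locales
       (auto simp: g_scale_def prod_eq_iff A.scale_right_distrib A.scale_left_distrib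
          Q.scale_right_distrib Q.scale_left_distrib)
qed

lemma quad_bracket_superset:
  assumes "finite B" "finite C" "Poly_Mapping.keys x \<subseteq> B" "Poly_Mapping.keys y \<subseteq> C"
  shows "quad_bracket x y = (\<Sum>b\<in>B. \<Sum>c\<in>C.
    quad_scale (Poly_Mapping.lookup x b * Poly_Mapping.lookup y c) (quad_basis_bracket b c))"
proof -
  have "quad_bracket x y = (\<Sum>b\<in>Poly_Mapping.keys x. \<Sum>c\<in>C.
    quad_scale (Poly_Mapping.lookup x b * Poly_Mapping.lookup y c) (quad_basis_bracket b c))"
    unfolding quad_bracket_def using assms
    by (intro sum.cong refl sum.mono_neutral_left) (auto simp: in_keys_iff)
  also have "\<dots> = (\<Sum>b\<in>B. \<Sum>c\<in>C.
    quad_scale (Poly_Mapping.lookup x b * Poly_Mapping.lookup y c) (quad_basis_bracket b c))"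
    using assms
    by (intro sum.mono_neutral_left) (auto simp: in_keys_iff)
  finally show ?thesis .
qed

lemma quad_bracket_add_left: "quad_bracket (x + y) z = quad_bracket x z + quad_bracket y z"
proof -
  let ?B = "Poly_Mapping.keys x \<union> Poly_Mapping.keys y" and ?C = "Poly_Mapping.keys z"
  have "Poly_Mapping.keys (x + y) \<subseteq> ?B" by (rule Poly_Mapping.keys_add)
  then show ?thesis
    by (simp add: quad_bracket_superset[of ?B ?C] lookup_add distrib_right Q.scale_left_distrib
          sum.distrib)
qed

lemma quad_bracket_add_right: "quad_bracket z (x + y) = quad_bracket z x + quad_bracket z y"
proof -
  let ?B = "Poly_Mapping.keys x \<union> Poly_Mapping.keys y" and ?C = "Poly_Mapping.keys z"
  have "Poly_Mapping.keys (x + y) \<subseteq> ?B" by (rule Poly_Mapping.keys_add)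
  then show ?thesis
    by (simp add: quad_bracket_superset[of ?C ?B] lookup_add distrib_left Q.scale_left_distrib
          sum.distrib)
qed

lemma keys_quad_scale: "Poly_Mapping.keys (quad_scale c x) \<subseteq> Poly_Mapping.keys x"
  by (auto simp: in_keys_iff)

lemma quad_bracket_scale_left: "quad_bracket (quad_scale c x) z = quad_scale c (quad_bracket x z)"
  using keys_quad_scale[of c x]
  by (simp add: quad_bracket_superset[of "Poly_Mapping.keys x" "Poly_Mapping.keys z"]
        Q.scale_sum_right mult.assoc)

lemma quad_bracket_scale_right: "quad_bracket z (quad_scale c x) = quad_scale c (quad_bracket z x)"
  using keys_quad_scale[of c x]
  by (simp add: quad_bracket_superset[of "Poly_Mapping.keys z" "Poly_Mapping.keys x"]
        Q.scale_sum_right mult_ac)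

lemma quad_bracket_minus_left [simp]: "quad_bracket (- x) z = - quad_bracket x z"
  using quad_bracket_scale_left[of "-1"] by simp

lemma quad_bracket_minus_right [simp]: "quad_bracket z (- x) = - quad_bracket z x"
  using quad_bracket_scale_right[of _ "-1"] by simp

lemma quad_bracket_zero [simp]: "quad_bracket 0 z = 0" "quad_bracket z 0 = 0"
  by (simp_all add: quad_bracket_def)

lemma quad_bracket_basis [simp]: "quad_bracket (qbasis b) (qbasis c) = quad_basis_bracket b c"
  by (simp add: quad_bracket_def)

lemma quad_part_induct [consumes 1, case_names zero add scale basis]:
  assumes "q \<in> quad_part i"
    and "P 0"
    and "\<And>x y. P x \<Longrightarrow> P y \<Longrightarrow> P (x + y)"
    and "\<And>c x. P x \<Longrightarrow> P (quad_scale c x)"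
    and "\<And>b. quad_parity b = i \<Longrightarrow> P (qbasis b)"
  shows "P q"
proof -
  have "P (\<Sum>b\<in>C. quad_scale (Poly_Mapping.lookup q b) (qbasis b))"
    if "finite C" "C \<subseteq> Poly_Mapping.keys q" for C
    using that
  proof induction
    case empty
    show ?case using assms(2) by simp
  next
    case (insert b C)
    have "quad_parity b = i" using insert.prems assms(1) by (simp add: quad_part_def)
    then have "P (quad_scale (Poly_Mapping.lookup q b) (qbasis b))" by (intro assms(4,5))
    moreover have "P (\<Sum>b\<in>C. quad_scale (Poly_Mapping.lookup q b) (qbasis b))"
      using insert by simp
    ultimately show ?case
      using assms(3) insert.hyps by simp
  qed
  from this[OF finite_keys subset_refl]
  have "P (\<Sum>b\<in>Poly_Mapping.keys q. quad_scale (Poly_Mapping.lookup q b) (qbasis b))" .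
  also have "(\<Sum>b\<in>Poly_Mapping.keys q. quad_scale (Poly_Mapping.lookup q b) (qbasis b)) = q"
  proof (rule poly_mapping_eqI)
    fix c
    have "Poly_Mapping.lookup
        (\<Sum>b\<in>Poly_Mapping.keys q. quad_scale (Poly_Mapping.lookup q b) (qbasis b)) c =
      (\<Sum>b\<in>Poly_Mapping.keys q. if b = c then Poly_Mapping.lookup q b else 0)"
      unfolding lookup_sum lookup_quad_scale lookup_single by (intro sum.cong) auto
    then show "Poly_Mapping.lookup
        (\<Sum>b\<in>Poly_Mapping.keys q. quad_scale (Poly_Mapping.lookup q b) (qbasis b)) c =
      Poly_Mapping.lookup q c"
      by (simp add: sum.delta' not_in_keys_iff_lookup_eq_zero)
  qed
  finally show ?thesis .
qed

lemma quad_subspace: "Q.subspace {q. Poly_Mapping.keys q \<subseteq> B}"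
proof (rule Q.subspaceI)
  fix x y :: quad and c
  assume x: "x \<in> {q. Poly_Mapping.keys q \<subseteq> B}"
  then show "quad_scale c x \<in> {q. Poly_Mapping.keys q \<subseteq> B}"
    using order_trans[OF keys_quad_scale[of c x]] by simp
  assume "y \<in> {q. Poly_Mapping.keys q \<subseteq> B}"
  with x show "x + y \<in> {q. Poly_Mapping.keys q \<subseteq> B}"
    using order_trans[OF Poly_Mapping.keys_add[of x y]] by simp
qed simp

lemma quad_part_keys: "quad_part i = {q. Poly_Mapping.keys q \<subseteq> {b. quad_parity b = i}}"
  by (auto simp: quad_part_def)

lemma quad_part_subspace: "Q.subspace (quad_part i)"
  unfolding quad_part_keys by (rule quad_subspace)

lemma quad_bracket_graded:
  assumes "x \<in> quad_part i" "y \<in> quad_part j"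
  shows "quad_bracket x y \<in> quad_part (i + j)"
proof -
  note [intro] = Q.subspace_add[OF quad_part_subspace] Q.subspace_scale[OF quad_part_subspace]
    Q.subspace_0[OF quad_part_subspace]
  have b: "quad_basis_bracket b c \<in> quad_part (quad_parity b + quad_parity c)" for b c
    by (cases b; cases c) (auto simp: quad_part_def)
  have "quad_bracket (qbasis b) y \<in> quad_part (i + j)" if "quad_parity b = i" for b
    using assms(2)
  proof (induction rule: quad_part_induct)
    case (basis c) then show ?case using b[of b c] that by (metis quad_bracket_basis)
  qed (auto simp: quad_bracket_add_right quad_bracket_scale_right)
  with assms(1) show ?thesis
    by (induction rule: quad_part_induct)
       (auto simp: quad_bracket_add_left quad_bracket_scale_left)
qed

lemma quad_bracket_skew:
  assumes "x \<in> quad_part i" "y \<in> quad_part j"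
  shows "quad_bracket x y = - quad_scale (super_sign i j) (quad_bracket y x)"
proof -
  note lin = quad_bracket_add_right quad_bracket_scale_right quad_bracket_add_left
    quad_bracket_scale_left Q.scale_right_distrib mult.commute
  have b: "quad_basis_bracket b c = 
      - quad_scale (super_sign (quad_parity b) (quad_parity c)) (quad_basis_bracket c b)" for b c
    by (cases b; cases c) (auto simp: super_sign_def add_ac)
  have "quad_bracket (qbasis b) y = - quad_scale (super_sign i j) (quad_bracket y (qbasis b))"
    if "quad_parity b = i" for b
    using assms(2)
  proof (induction rule: quad_part_induct)
    case (basis c) then show ?case using b[of b c] that by simp
  qed (simp_all add: lin)
  with assms(1) show ?thesis
    by (induction rule: quad_part_induct)
       (simp_all add: lin)
qed

lemma quad_bracket_jacobi:
  assumes "x \<in> quad_part i" "y \<in> quad_part j" "z \<in> quad_part k"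
  shows "quad_bracket x (quad_bracket y z) =
    quad_bracket (quad_bracket x y) z + quad_scale (super_sign i j) (quad_bracket y (quad_bracket x z))"
    (is "?J x y z")
proof -
  note lin = quad_bracket_add_right quad_bracket_scale_right quad_bracket_add_left
    quad_bracket_scale_left Q.scale_right_distrib mult_ac
  have b: "?J (qbasis a) (qbasis b) (qbasis c)" if "quad_parity a = i" "quad_parity b = j" for a b c
    using that by (cases a; cases b; cases c) (auto simp: super_sign_def algebra_simps)
  have 1: "?J (qbasis a) (qbasis b) z" if "quad_parity a = i" "quad_parity b = j" for a b
    using assms(3)
  proof (induction rule: quad_part_induct)
    case (basis c) then show ?case using b[of a b c] that by blast
  qed (simp_all add: lin)
  have 2: "?J (qbasis a) y z" if "quad_parity a = i" for a
    using assms(2)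
  proof (induction rule: quad_part_induct)
    case (basis c) then show ?case using 1[of a c] that by blast
  qed (simp_all add: lin)
  show ?thesis
    using assms(1)
  proof (induction rule: quad_part_induct)
    case (basis c) then show ?case using 2[of c] by blast
  qed (simp_all add: lin)
qed

lemma lie_superalgebra_g:
  assumes "graded_abelian_lie_algebra sA brA G"
  shows "lie_superalgebra (g_scale sA) g_part (g_bracket brA)"
proof -
  interpret A: graded_abelian_lie_algebra sA brA G by fact
  interpret g: vector_space "g_scale sA"
    by (rule vector_space_g_scale) unfold_locales
  show ?thesis
  proof
    show "g.subspace (g_part i)" for i
      using quad_part_subspace[of i] A.L_subspace[of i]
      unfolding g.subspace_def Q.subspace_def A.subspace_def
      by (auto simp: g_part_def g_scale_def zero_prod_def split: if_splits)
    show "g_part 0 \<inter> g_part 1 = ({0} :: ('a \<times> quad) set)"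
      by (auto simp: g_part_def quad_part_def prod_eq_iff)
    show "linear_on (g_scale sA) (g_scale sA) (supercarrier g_part) (\<lambda>x. g_bracket brA x y)"
      for y :: "'a \<times> quad"
      by (simp add: linear_on_def g_bracket_def g_scale_def A.abelian quad_bracket_add_left
            quad_bracket_scale_left)
    show "linear_on (g_scale sA) (g_scale sA) (supercarrier g_part) (g_bracket brA x)"
      for x :: "'a \<times> quad"
      by (simp add: linear_on_def g_bracket_def g_scale_def A.abelian quad_bracket_add_right
            quad_bracket_scale_right)
    fix x y z :: "'a \<times> quad" and i j k
    assume xy: "x \<in> g_part i" "y \<in> g_part j"
    then have q: "snd x \<in> quad_part i" "snd y \<in> quad_part j" by (auto simp: g_part_def)
    show "g_bracket brA x y \<in> g_part (i + j)"
      using quad_bracket_graded[OF q] by (auto simp: g_bracket_def g_part_def A.abelian)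
    show "g_bracket brA x y = - g_scale sA (super_sign i j) (g_bracket brA y x)"
      using quad_bracket_skew[OF q] by (simp add: g_bracket_def g_scale_def A.abelian)
    assume "z \<in> g_part k"
    then have "snd z \<in> quad_part k" by (auto simp: g_part_def)
    from quad_bracket_jacobi[OF q this]
    show "g_bracket brA x (g_bracket brA y z) = g_bracket brA (g_bracket brA x y) z +
        g_scale sA (super_sign i j) (g_bracket brA y (g_bracket brA x z))"
      by (simp add: g_bracket_def g_scale_def A.abelian)
  qed
qed

lemma lie_superalgebra_k:
  assumes "graded_abelian_lie_algebra sA brA G"
  shows "lie_superalgebra (g_scale sA) k_part (g_bracket brA)"
proof -
  interpret A: graded_abelian_lie_algebra sA brA G by fact
  interpret g: lie_superalgebra "g_scale sA" g_part "g_bracket brA"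
    by (rule lie_superalgebra_g) fact
  have sub: "k_part i \<subseteq> g_part i" for i
    by (auto simp: k_part_def g_part_def quad_part_def)
  then have sup: "supercarrier k_part \<subseteq> (supercarrier g_part :: ('a \<times> quad) set)"
    by (fastforce simp: supercarrier_def)
  have T2: "quad_basis_bracket (T2 n) b = 0" "quad_basis_bracket b (T2 n) = 0" for n b
    by (cases b; simp)+
  have T2_left: "quad_bracket p q = 0" if "Poly_Mapping.keys p \<subseteq> range T2" for p q
  proof -
    have "quad_basis_bracket b c = 0" if "b \<in> Poly_Mapping.keys p" for b c
      using that T2(1) \<open>Poly_Mapping.keys p \<subseteq> range T2\<close> by blast
    then show ?thesis by (simp add: quad_bracket_def)
  qed
  have T2_right: "quad_bracket p q = 0" if "Poly_Mapping.keys q \<subseteq> range T2" for p q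
  proof -
    have "quad_basis_bracket b c = 0" if "c \<in> Poly_Mapping.keys q" for b c
      using that T2(2) \<open>Poly_Mapping.keys q \<subseteq> range T2\<close> by blast
    then show ?thesis by (simp add: quad_bracket_def)
  qed
  have odd: "Poly_Mapping.keys (quad_basis_bracket b c) \<subseteq> range T2"
    if "quad_parity b = 1" "quad_parity c = 1" for b c
    using that by (cases b; cases c) auto
  have odd_odd: "Poly_Mapping.keys (quad_bracket p q) \<subseteq> range T2"
    if "p \<in> quad_part 1" "q \<in> quad_part 1" for p q
  proof -
    have "Poly_Mapping.keys (quad_scale c (quad_basis_bracket b b')) \<subseteq> range T2"
      if "b \<in> Poly_Mapping.keys p" "b' \<in> Poly_Mapping.keys q" for b b' c
      using odd[of b b'] keys_quad_scale[of c "quad_basis_bracket b b'"] that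
        \<open>p \<in> quad_part 1\<close> \<open>q \<in> quad_part 1\<close>
      unfolding quad_part_def by blast
    then show ?thesis
      unfolding quad_bracket_def
      by (intro Q.subspace_sum[OF quad_subspace[of "range T2"], unfolded mem_Collect_eq])
  qed
  show ?thesis
  proof
    show "g.subspace (k_part i)" for i
      using quad_subspace[of "range T2"] g.L_subspace[of 1]
      unfolding g.subspace_def Q.subspace_def A.subspace_def
      by (auto simp: k_part_def g_scale_def zero_prod_def split: if_splits)
    show "k_part 0 \<inter> k_part 1 = ({0} :: ('a \<times> quad) set)"
      using g.L_direct sub[of 0] by (auto simp: k_part_def g_part_def zero_prod_def)
    show "g_bracket brA x y \<in> k_part (i + j)" if "x \<in> k_part i" "y \<in> k_part j" for x y i j
    proof -
      consider "i = 1" "j = 1" | "i = 0" | "j = 0"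
        using bit_not_one_iff by blast
      then show ?thesis
      proof cases
        case 1
        with that odd_odd[of "snd x" "snd y"] show ?thesis
          by (simp add: k_part_def g_part_def g_bracket_def mem_Times_iff)
      next
        case 2
        with that T2_left[of "snd x" "snd y"] show ?thesis
          by (simp add: k_part_def g_part_def g_bracket_def A.abelian mem_Times_iff quad_part_def)
      next
        case 3
        with that T2_right[of "snd y" "snd x"] show ?thesis
          by (simp add: k_part_def g_part_def g_bracket_def A.abelian mem_Times_iff quad_part_def)
      qed
    qed
    show "linear_on (g_scale sA) (g_scale sA) (supercarrier k_part) (\<lambda>x. g_bracket brA x y)"
      if "y \<in> supercarrier k_part" for y
      using g.br_linear_left[of y] that sup unfolding linear_on_def by blast
    show "linear_on (g_scale sA) (g_scale sA) (supercarrier k_part) (g_bracket brA x)"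
      if "x \<in> supercarrier k_part" for x
      using g.br_linear_right[of x] that sup unfolding linear_on_def by blast
    show "g_bracket brA x y = - g_scale sA (super_sign i j) (g_bracket brA y x)"
      if "x \<in> k_part i" "y \<in> k_part j" for x y i j
      using g.br_skew[of x i y j] that sub by blast
    show "g_bracket brA x (g_bracket brA y z) = g_bracket brA (g_bracket brA x y) z +
        g_scale sA (super_sign i j) (g_bracket brA y (g_bracket brA x z))"
      if "x \<in> k_part i" "y \<in> k_part j" "z \<in> k_part k" for x y z i j k
      using g.br_jacobi[of x i y j z k] that sub by blast
  qed
qed

lemma S_proj_mem: "S_proj x \<in> S_space"
  by (auto simp: S_proj_def S_space_def in_keys_iff lookup_mapp when_def split: if_splits)

lemma lookup_S_proj:
  "Poly_Mapping.lookup (snd (S_proj x)) b =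
     (if b \<in> range S2 then Poly_Mapping.lookup (snd x) b else 0)"
  by (auto simp: S_proj_def lookup_mapp when_def in_keys_iff)

lemma k_proj_mem: "k_proj x \<in> supercarrier k_part"
proof -
  define p where "p B = Poly_Mapping.mapp (\<lambda>b c. if b \<in> B then c else 0) (snd x)" for B
  have l: "Poly_Mapping.lookup (p B) b = (if b \<in> B then Poly_Mapping.lookup (snd x) b else 0)" for B b
    by (auto simp: p_def lookup_mapp when_def in_keys_iff)
  have "k_proj x = (fst x, p (range T2)) + (0, p (range T1 \<union> range Tm1))"
  proof (rule prod_eqI)
    show "snd (k_proj x) = snd ((fst x, p (range T2)) + (0, p (range T1 \<union> range Tm1)))"
    proof (rule poly_mapping_eqI)
      fix b show "Poly_Mapping.lookup (snd (k_proj x)) b =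
        Poly_Mapping.lookup (snd ((fst x, p (range T2)) + (0, p (range T1 \<union> range Tm1)))) b"
        by (cases b) (auto simp: k_proj_def lookup_minus lookup_add l lookup_S_proj)
    qed
  qed (simp add: k_proj_def S_proj_def)
  moreover have "(fst x, p (range T2)) \<in> k_part 0" "(0, p (range T1 \<union> range Tm1)) \<in> k_part 1"
    by (auto simp: k_part_def g_part_def quad_part_def in_keys_iff l split: if_splits)
  ultimately show ?thesis
    unfolding supercarrier_def by blast
qed

lemma S_proj_S:
  assumes "z \<in> S_space"
  shows "S_proj z = z"
proof (rule prod_eqI)
  show "fst (S_proj z) = fst z"
    using assms by (auto simp: S_proj_def S_space_def)
  have "Poly_Mapping.lookup (snd z) b = 0" if "b \<notin> range S2" for b
    using assms that by (auto simp: S_space_def in_keys_iff subset_iff)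
  then show "snd (S_proj z) = snd z"
    by (intro poly_mapping_eqI) (simp add: lookup_S_proj)
qed

lemma S_proj_k:
  assumes "x \<in> supercarrier k_part"
  shows "S_proj x = 0"
proof -
  have "b \<notin> range S2" if "b \<in> Poly_Mapping.keys (snd x)" for b
  proof -
    obtain y z where "x = y + z" "y \<in> k_part 0" "z \<in> k_part 1"
      using assms by (auto simp: supercarrier_def)
    then have "Poly_Mapping.keys (snd y) \<subseteq> range T2" "\<forall>b\<in>Poly_Mapping.keys (snd z). quad_parity b = 1"
      "snd x = snd y + snd z"
      by (auto simp: k_part_def g_part_def quad_part_def)
    with that Poly_Mapping.keys_add[of "snd y" "snd z"] show ?thesis by fastforce
  qed
  then have "Poly_Mapping.lookup (snd (S_proj x)) b = 0" for b
    using in_keys_iff[of b "snd x"] by (auto simp: lookup_S_proj)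
  then have "snd (S_proj x) = 0" by (intro poly_mapping_eqI) simp
  then show ?thesis by (simp add: S_proj_def prod_eq_iff)
qed

lemma Omega_act_k:
  assumes "vector_space sV" "linear_on (g_scale sA) (*) S_space rho"
    and "\<And>v. linear_on (g_scale sA) sV S_space (\<lambda>z. phi z v)"
    and "x \<in> supercarrier k_part"
  shows "Omega_act sV act rho phi x v = act x v"
proof -
  interpret vector_space sV by fact
  have "0 \<in> S_space" by (simp add: S_space_def zero_prod_def)
  then have "rho (0 + 0) = rho 0 + rho 0" "phi (0 + 0) v = phi 0 v + phi 0 v"
    using assms(2,3) unfolding linear_on_def by blast+
  then show ?thesis
    using S_proj_k[OF assms(4)] by (simp add: Omega_act_def k_proj_def)
qed

lemma Omega_act_S:
  fixes sA :: "complex \<Rightarrow> 'a::ab_group_add \<Rightarrow> 'a"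
  assumes "lie_supermodule (g_scale sA) k_part (g_bracket brA) sV V act" "z \<in> S_space"
  shows "Omega_act sV act rho phi z v = sV (rho z) v + phi z v"
proof -
  interpret lie_supermodule "g_scale sA" k_part "g_bracket brA" sV V act by fact
  have "(0 :: 'a \<times> quad) \<in> supercarrier k_part"
    using subspace_0[OF L_subspace[of 0]] subspace_0[OF L_subspace[of 1]]
    unfolding supercarrier_def by (intro CollectI exI[of _ 0]) simp
  with act_linear_left[of v] have "act (0 + 0) v = act 0 v + act 0 v"
    unfolding linear_on_def by blast
  then show ?thesis
    using S_proj_S[OF assms(2)] by (simp add: Omega_act_def k_proj_def)
qed

end

theory Submission
  imports Defs
begin

text \<open>
  That \<open>\<Omega>\<close> is a module comes down to the compatibility of the action with brackets \<open>[x, y]\<close> of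
  homogeneous elements (\<open>lie_supermodule_Omega\<close>). Write \<open>x = a + s\<close> and
  \<open>y = b + t\<close> along \<open>g = k \<oplus> S\<close>, and let \<open>D s\<close> be the operator \<open>v \<mapsto> \<rho>(s)v + \<phi>(s)v\<close>. All brackets lie in \<open>k\<close> (\<open>g_bracket_mem_k\<close>)
  and \<open>[S, S] = 0\<close>, so \<open>[x, y]\<close> acts on \<open>\<Omega>\<close> as
  \<open>[a, b] + [s, b] + [a, t]\<close> acts on \<open>V\<close>. Scalars commute with every linear operator, so
  \<open>D s\<close> satisfies the same relations as \<open>\<phi>(s)\<close>: it commutes with \<open>D t\<close>, and its commutator
  with the action of \<open>b\<close> is the action of \<open>[s, b]\<close>. If \<open>x\<close> or \<open>y\<close> is even, the sign in the module axiom
  is \<open>+1\<close> and these relations give the claim; if both are odd, then \<open>s = t = 0\<close>, and the claim is the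
  module axiom for \<open>k\<close>. Simplicity is inherited, because a graded \<open>g\<close>-submodule is in particular
  a graded \<open>k\<close>-submodule of the simple \<open>k\<close>-module \<open>V\<close>.
\<close>

section \<open>The decomposition of \<open>g\<close> along \<open>k\<close> and \<open>S\<close>\<close>

lemma S_proj_add: "S_proj (x + y) = S_proj x + S_proj y"
proof (rule prod_eqI)
  show "snd (S_proj (x + y)) = snd (S_proj x + S_proj y)"
    by (rule poly_mapping_eqI) (simp add: lookup_S_proj lookup_add)
qed (simp add: S_proj_def)

lemma S_proj_scale:
  assumes "vector_space sA"
  shows "S_proj (g_scale sA c x) = g_scale sA c (S_proj x)"
proof (rule prod_eqI)
  interpret A: vector_space sA by fact
  show "fst (S_proj (g_scale sA c x)) = fst (g_scale sA c (S_proj x))"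
    by (simp add: S_proj_def g_scale_def)
  show "snd (S_proj (g_scale sA c x)) = snd (g_scale sA c (S_proj x))"
    by (rule poly_mapping_eqI) (simp add: lookup_S_proj g_scale_def)
qed

lemma k_proj_add: "k_proj (x + y) = k_proj x + k_proj y"
  by (simp add: k_proj_def S_proj_add)

lemma k_proj_scale:
  assumes "vector_space sA"
  shows "k_proj (g_scale sA c x) = g_scale sA c (k_proj x)"
proof -
  interpret vector_space "g_scale sA"
    by (rule vector_space_g_scale) fact
  show ?thesis
    by (simp add: k_proj_def S_proj_scale[OF assms] scale_right_diff_distrib)
qed

lemma S_proj_odd:
  assumes "x \<in> g_part 1"
  shows "S_proj x = 0"
proof (rule S_proj_k)
  have "0 + x \<in> supercarrier k_part"
    unfolding supercarrier_def using assms
    by (intro CollectI exI[of _ 0] exI[of _ x]) (simp add: k_part_def mem_Times_iff)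
  then show "x \<in> supercarrier k_part" by simp
qed

lemma k_proj_graded:
  assumes "x \<in> g_part i"
  shows "k_proj x \<in> k_part i"
proof (cases "i = 0")
  case True
  have "b \<in> range T2" if b: "b \<in> Poly_Mapping.keys (snd (k_proj x))" for b
  proof -
    have "Poly_Mapping.lookup (snd x) b \<noteq> 0" "b \<notin> range S2"
      using b by (auto simp: k_proj_def lookup_minus lookup_S_proj in_keys_iff split: if_splits)
    moreover from this have "quad_parity b = 0"
      using assms True by (auto simp: g_part_def quad_part_def in_keys_iff)
    ultimately show ?thesis by (cases b) auto
  qed
  then show ?thesis using True by (auto simp: k_part_def mem_Times_iff)
next
  case False
  then have "i = 1" by simp
  with assms show ?thesis by (simp add: k_proj_def S_proj_odd k_part_def)
qed

lemma k_part_subset_g_part: "k_part i \<subseteq> g_part i"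
  by (auto simp: k_part_def g_part_def quad_part_def)

lemma supercarrier_k_subset_g: "supercarrier k_part \<subseteq> supercarrier g_part"
  using k_part_subset_g_part unfolding supercarrier_def by blast

lemma S_space_even: "S_space \<subseteq> g_part 0"
  by (auto simp: S_space_def g_part_def quad_part_def)

lemma supercarrier_k_iff: "x \<in> supercarrier k_part \<longleftrightarrow> S_proj x = 0"
  using S_proj_k[of x] k_proj_mem[of x] by (auto simp: k_proj_def)

section \<open>Brackets relative to the decomposition\<close>

text \<open>The commutator space of \<open>g\<close> lies in \<open>k\<close>, because the bracket of two basis vectors
  never has a component in \<open>S\<close>.\<close>

lemma g_bracket_mem_k:
  assumes "\<And>x y. brA x y = 0"
  shows "g_bracket brA x y \<in> supercarrier k_part"
proof -
  have "Poly_Mapping.lookup (quad_basis_bracket b c) (S2 n) = 0" for b c n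
    by (cases b; cases c) (auto simp: lookup_single)
  then have "Poly_Mapping.lookup (quad_bracket p q) (S2 n) = 0" for p q n
    by (simp add: quad_bracket_def lookup_sum)
  then have "snd (S_proj (g_bracket brA x y)) = 0"
    by (intro poly_mapping_eqI) (auto simp: lookup_S_proj g_bracket_def)
  then show ?thesis
    by (simp add: supercarrier_k_iff S_proj_def prod_eq_iff)
qed

lemma g_bracket_S_S:
  assumes "\<And>x y. brA x y = 0" "z \<in> S_space" "z' \<in> S_space"
  shows "g_bracket brA z z' = 0"
proof -
  have "quad_basis_bracket b c = 0"
    if "b \<in> Poly_Mapping.keys (snd z)" "c \<in> Poly_Mapping.keys (snd z')" for b c
  proof -
    have "b \<in> range S2" "c \<in> range S2"
      using that assms(2,3) by (auto simp: S_space_def)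
    then show ?thesis by auto
  qed
  then have "quad_bracket (snd z) (snd z') = 0"
    by (simp add: quad_bracket_def)
  with assms(1) show ?thesis by (simp add: g_bracket_def zero_prod_def)
qed

lemma g_bracket_add_left:
  fixes brA :: "'a::ab_group_add \<Rightarrow> 'a \<Rightarrow> 'a"
  assumes "\<And>x y. brA x y = 0"
  shows "g_bracket brA (x + y) z = g_bracket brA x z + g_bracket brA y z"
  using assms by (simp add: g_bracket_def quad_bracket_add_left)

lemma g_bracket_add_right:
  fixes brA :: "'a::ab_group_add \<Rightarrow> 'a \<Rightarrow> 'a"
  assumes "\<And>x y. brA x y = 0"
  shows "g_bracket brA z (x + y) = g_bracket brA z x + g_bracket brA z y"
  using assms by (simp add: g_bracket_def quad_bracket_add_right)

lemma g_bracket_even_skew: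
  assumes "\<And>x y. brA x y = 0" "z \<in> S_space" "x \<in> g_part i"
  shows "g_bracket brA x z = - g_bracket brA z x"
proof -
  have "snd x \<in> quad_part i" "snd z \<in> quad_part 0"
    using assms(2,3) S_space_even by (auto simp: g_part_def)
  from quad_bracket_skew[OF this] have "quad_bracket (snd x) (snd z) = - quad_bracket (snd z) (snd x)"
    by (simp add: super_sign_def)
  then show ?thesis using assms(1) by (simp add: g_bracket_def prod_eq_iff)
qed

section \<open>The module structure on \<open>\<Omega>\<close>\<close>

text \<open>
  For any \<open>k\<close>-module \<open>V\<close>, a commuting family of even operators \<open>\<phi>(z)\<close> whose commutators with \<open>k\<close> are
  those of \<open>S\<close> extends the action to \<open>g\<close>, and it may be shifted by scalars \<open>\<rho>(z)\<close>.
\<close>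

lemma lie_supermodule_Omega:
  fixes sA :: "complex \<Rightarrow> 'a::ab_group_add \<Rightarrow> 'a"
    and sV :: "complex \<Rightarrow> 'v::ab_group_add \<Rightarrow> 'v"
  assumes A: "graded_abelian_lie_algebra sA brA G"
    and k: "lie_supermodule (g_scale sA) k_part (g_bracket brA) sV V act"
    and rho: "linear_on (g_scale sA) (*) S_space rho"
    and phi: "\<And>v. linear_on (g_scale sA) sV S_space (\<lambda>z. phi z v)"
    and even: "\<And>z. z \<in> S_space \<Longrightarrow> linear_even_endo sV V (phi z)"
    and phi_act: "\<And>z x v. z \<in> S_space \<Longrightarrow> x \<in> supercarrier k_part \<Longrightarrow>
           phi z (act x v) - act x (phi z v) = act (g_bracket brA z x) v"
    and phi_phi: "\<And>z z' v. z \<in> S_space \<Longrightarrow> z' \<in> S_space \<Longrightarrow>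
           phi z (phi z' v) - phi z' (phi z v) = 0"
  shows "lie_supermodule (g_scale sA) g_part (g_bracket brA) sV V (Omega_act sV act rho phi)"
proof -
  interpret A: graded_abelian_lie_algebra sA brA G by fact
  interpret g: lie_superalgebra "g_scale sA" g_part "g_bracket brA"
    by (rule lie_superalgebra_g) fact
  interpret k: lie_supermodule "g_scale sA" k_part "g_bracket brA" sV V act by fact
  have vsA: "vector_space sA" by unfold_locales
  note abelian = A.abelian
  define D where "D z v = sV (rho z) v + phi z v" for z v
  have Omega: "Omega_act sV act rho phi x v = act (k_proj x) v + D (S_proj x) v" for x v
    by (simp add: Omega_act_def D_def)
  have Omega_k: "Omega_act sV act rho phi x v = act x v" if "x \<in> supercarrier k_part" for x v
    using Omega_act_k[OF k.V.vector_space_axioms rho phi that] .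
  have act_lin: "Vector_Spaces.linear sV sV (act x)" if "x \<in> supercarrier k_part" for x
    using k.act_linear_right[OF that] .
  have act_add_left: "act (x + y) v = act x v + act y v"
    if "x \<in> supercarrier k_part" "y \<in> supercarrier k_part" for x y v
    using k.act_linear_left[of v] that unfolding linear_on_def by blast
  have act_scale_left: "act (g_scale sA c x) v = sV c (act x v)" if "x \<in> supercarrier k_part" for c x v
    using k.act_linear_left[of v] that unfolding linear_on_def by blast
  have phi_lin: "Vector_Spaces.linear sV sV (phi z)" if "z \<in> S_space" for z
    using even[OF that] by (simp add: linear_even_endo_def)
  have D_lin: "Vector_Spaces.linear sV sV (D z)" if "z \<in> S_space" for z
  proof -
    interpret phi: Vector_Spaces.linear sV sV "phi z" by (rule phi_lin) fact
    show ?thesis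
      by unfold_locales
        (simp_all add: D_def phi.add phi.scale k.V.scale_right_distrib mult.commute)
  qed
  have rho_add: "rho (z + z') = rho z + rho z'" and phi_add: "phi (z + z') v = phi z v + phi z' v"
    if "z \<in> S_space" "z' \<in> S_space" for z z' v
    using rho phi[of v] that unfolding linear_on_def by blast+
  have rho_scale: "rho (g_scale sA c z) = c * rho z" and phi_scale: "phi (g_scale sA c z) v = sV c (phi z v)"
    if "z \<in> S_space" for c z v
    using rho phi[of v] that unfolding linear_on_def by blast+
  have D_add: "D (z + z') v = D z v + D z' v" if "z \<in> S_space" "z' \<in> S_space" for z z' v
    using that by (simp add: D_def rho_add phi_add k.V.scale_left_distrib)
  have D_scale: "D (g_scale sA c z) v = sV c (D z v)" if "z \<in> S_space" for c z v
    using that by (simp add: D_def rho_scale phi_scale k.V.scale_right_distrib)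
  have D_zero: "D 0 v = 0" for v
  proof -
    have "0 \<in> S_space" by (simp add: S_space_def zero_prod_def)
    from D_add[OF this this, of v] show ?thesis by simp
  qed
  have D_act: "D z (act x v) = act x (D z v) + act (g_bracket brA z x) v"
    if "z \<in> S_space" "x \<in> supercarrier k_part" for z x v
  proof -
    interpret act: Vector_Spaces.linear sV sV "act x" by (rule act_lin) fact
    show ?thesis
      using phi_act[OF that, of v] by (simp add: D_def act.add act.scale algebra_simps)
  qed
  have D_D: "D z (D z' v) = D z' (D z v)" if "z \<in> S_space" "z' \<in> S_space" for z z' v
  proof -
    interpret phi: Vector_Spaces.linear sV sV "phi z" by (rule phi_lin) fact
    interpret phi': Vector_Spaces.linear sV sV "phi z'" by (rule phi_lin) fact
    show ?thesis
      using phi_phi[OF that, of v]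
      by (simp add: D_def phi.add phi.scale phi'.add phi'.scale k.V.scale_right_distrib
          mult.commute add_ac)
  qed
  show ?thesis
  proof (intro lie_supermodule.intro lie_supermodule_axioms.intro)
    show "linear_on (g_scale sA) sV (supercarrier g_part) (\<lambda>x. Omega_act sV act rho phi x v)" for v
      by (simp add: linear_on_def Omega k_proj_add k_proj_scale[OF vsA] S_proj_add S_proj_scale[OF vsA]
          act_add_left act_scale_left D_add D_scale k_proj_mem S_proj_mem k.V.scale_right_distrib)
    show "Vector_Spaces.linear sV sV (Omega_act sV act rho phi x)" for x
    proof -
      interpret act: Vector_Spaces.linear sV sV "act (k_proj x)" by (rule act_lin) (rule k_proj_mem)
      interpret D: Vector_Spaces.linear sV sV "D (S_proj x)" by (rule D_lin) (rule S_proj_mem)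
      show ?thesis
        by unfold_locales
          (simp_all add: Omega act.add act.scale D.add D.scale k.V.scale_right_distrib)
    qed
    show "Omega_act sV act rho phi x v \<in> V (i + j)" if x: "x \<in> g_part i" and v: "v \<in> V j" for x v i j
    proof (cases "i = 0")
      case True
      have "phi (S_proj x) v \<in> V j"
        using even[OF S_proj_mem[of x]] v unfolding linear_even_endo_def by blast
      then have "D (S_proj x) v \<in> V j"
        unfolding D_def
        by (intro k.V.subspace_add[OF k.V_subspace] k.V.subspace_scale[OF k.V_subspace] v)
      moreover have "act (k_proj x) v \<in> V j"
        using k.act_graded[OF k_proj_graded[OF x] v] by (simp only: True add_0)
      ultimately show ?thesis
        unfolding Omega True add_0 by (intro k.V.subspace_add[OF k.V_subspace])
    next
      case False
      then have "S_proj x = 0" using x S_proj_odd by simp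
      then show ?thesis
        using k.act_graded[OF k_proj_graded[OF x] v] by (simp add: Omega D_zero)
    qed
    show "Omega_act sV act rho phi (g_bracket brA x y) v =
        Omega_act sV act rho phi x (Omega_act sV act rho phi y v) -
        sV (super_sign i j) (Omega_act sV act rho phi y (Omega_act sV act rho phi x v))"
      if x: "x \<in> g_part i" and y: "y \<in> g_part j" for x y v i j
    proof (cases "i = 1 \<and> j = 1")
      case True
      then have "x \<in> k_part i" "y \<in> k_part j"
        using x y by (simp_all add: k_part_def)
      moreover have "x \<in> supercarrier k_part" "y \<in> supercarrier k_part"
        using True x y by (simp_all add: supercarrier_k_iff S_proj_odd)
      ultimately show ?thesis
        by (simp add: Omega_k g_bracket_mem_k[of brA, OF abelian] k.act_br)
    next
      case False
      define a b s t where "a = k_proj x" and "b = k_proj y" and "s = S_proj x" and "t = S_proj y"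
      have xy: "x = a + s" "y = b + t"
        by (simp_all add: a_def b_def s_def t_def k_proj_def)
      have a: "a \<in> k_part i" and b: "b \<in> k_part j"
        using x y by (simp_all add: a_def b_def k_proj_graded)
      have ab: "a \<in> supercarrier k_part" "b \<in> supercarrier k_part"
        by (simp_all add: a_def b_def k_proj_mem)
      have st: "s \<in> S_space" "t \<in> S_space"
        by (simp_all add: s_def t_def S_proj_mem)
      interpret a: Vector_Spaces.linear sV sV "act a" by (rule act_lin) fact
      interpret b: Vector_Spaces.linear sV sV "act b" by (rule act_lin) fact
      interpret s: Vector_Spaces.linear sV sV "D s" by (rule D_lin) fact
      interpret t: Vector_Spaces.linear sV sV "D t" by (rule D_lin) fact
      note mem = g_bracket_mem_k[of brA, OF abelian]
      have sign: "super_sign i j = 1" using False by (simp add: super_sign_def)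
      have "g_bracket brA a t = - g_bracket brA t a"
        using g_bracket_even_skew[of brA, OF abelian st(2)] a k_part_subset_g_part by blast
      also have "\<dots> = g_scale sA (-1) (g_bracket brA t a)" by simp
      finally have at: "act (g_bracket brA a t) v = - act (g_bracket brA t a) v"
        using act_scale_left[OF mem, of "-1"] by simp
      have "g_bracket brA x y = g_bracket brA a b + g_bracket brA s b + g_bracket brA a t"
        unfolding xy using g_bracket_S_S[of brA, OF abelian st]
        by (simp add: g_bracket_add_left[of brA, OF abelian] g_bracket_add_right[of brA, OF abelian])
      moreover have "g_bracket brA a b + g_bracket brA s b \<in> supercarrier k_part"
        using mem[of "a + s" b] by (simp add: g_bracket_add_left[of brA, OF abelian])
      ultimately have "act (g_bracket brA x y) v =
          act (g_bracket brA a b) v + act (g_bracket brA s b) v - act (g_bracket brA t a) v"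
        by (simp add: act_add_left mem at)
      also have "act (g_bracket brA a b) v = act a (act b v) - act b (act a v)"
        using k.act_br[OF a b, of v] sign by simp
      also have "act (g_bracket brA s b) v = D s (act b v) - act b (D s v)"
        by (simp add: D_act st ab)
      also have "act (g_bracket brA t a) v = D t (act a v) - act a (D t v)"
        by (simp add: D_act st ab)
      finally show ?thesis
        unfolding Omega_k[OF mem]
        unfolding Omega sign a_def[symmetric] b_def[symmetric]
          s_def[symmetric] t_def[symmetric]
        by (simp add: a.add b.add s.add t.add D_D[OF st] algebra_simps)
    qed
  qed (use g.lie_superalgebra_axioms k.V.vector_space_axioms k.V_subspace k.V_direct k.V_total
      in auto)
qed

theorem proposition3p6:
  fixes sA :: "complex \<Rightarrow> 'a::ab_group_add \<Rightarrow> 'a"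
    and brA :: "'a \<Rightarrow> 'a \<Rightarrow> 'a"
    and G :: "int \<Rightarrow> 'a set"
    and lam :: "'a \<times> quad \<Rightarrow> complex"
    and sV :: "complex \<Rightarrow> 'v::ab_group_add \<Rightarrow> 'v"
    and V :: "bit \<Rightarrow> 'v set"
    and act :: "'a \<times> quad \<Rightarrow> 'v \<Rightarrow> 'v"
    and rho :: "'a \<times> quad \<Rightarrow> complex"
    and phi :: "'a \<times> quad \<Rightarrow> 'v \<Rightarrow> 'v"
  assumes "graded_abelian_lie_algebra sA brA G"
    and "linear_on (g_scale sA) (*) (k_part 0) lam"
    and "coradical_finite sA brA lam"
    and "is_V_c sA brA lam sV V act"
    and "linear_on (g_scale sA) (*) S_space rho"
    and "\<And>v. linear_on (g_scale sA) sV S_space (\<lambda>z. phi z v)"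
    and "\<And>z. z \<in> S_space \<Longrightarrow> linear_even_endo sV V (phi z)"
    and "\<And>z x v. z \<in> S_space \<Longrightarrow> x \<in> supercarrier k_part \<Longrightarrow>
           phi z (act x v) - act x (phi z v) = act (g_bracket brA z x) v"
    and "\<And>z z' v. z \<in> S_space \<Longrightarrow> z' \<in> S_space \<Longrightarrow>
           phi z (phi z' v) - phi z' (phi z v) = 0"
  shows "simple_supermodule (g_scale sA) g_part (g_bracket brA) sV V (Omega_act sV act rho phi)
         \<and> finite_dimensional sV"
proof (intro conjI)
  have k: "lie_supermodule (g_scale sA) k_part (g_bracket brA) sV V act"
    and nonzero: "\<exists>v::'v. v \<noteq> 0"
    and simple: "\<And>W. graded_submodule k_part sV V act W \<Longrightarrow> W = {0} \<or> W = UNIV"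
    using assms(4) by (auto simp: is_V_c_def simple_supermodule_def)
  interpret k: lie_supermodule "g_scale sA" k_part "g_bracket brA" sV V act by (rule k)
  have "graded_submodule k_part sV V act W"
    if W: "graded_submodule g_part sV V (Omega_act sV act rho phi) W" for W
  proof -
    have "act x w \<in> W" if x: "x \<in> supercarrier k_part" and "w \<in> W" for x w
    proof -
      have "Omega_act sV act rho phi x w \<in> W"
        using W that supercarrier_k_subset_g unfolding graded_submodule_def by blast
      then show ?thesis
        using Omega_act_k[OF k.V.vector_space_axioms assms(5,6) x] by simp
    qed
    with W show ?thesis by (simp add: graded_submodule_def)
  qed
  with simple nonzero lie_supermodule_Omega[OF assms(1) k assms(5-9)]
  show "simple_supermodule (g_scale sA) g_part (g_bracket brA) sV V (Omega_act sV act rho phi)"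
    unfolding simple_supermodule_def by blast
  show "finite_dimensional sV"
    using assms(4) by (simp add: is_V_c_def)
qed

end
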